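(* Let $P_{\mathcal T}$ and $P_{\mathcal V}$ be probability distributions over pairs $(x,y)$ (the training and validation distributions), let $\mathcal F$ be a class of predictors, let $\ell$ be a real-valued loss, and let $n\ge 1$ be an integer. For $i\in\{0,1,\dots,n\}$ let $M_i = \left(1-\tfrac{i}{n}\right)P_{\mathcal T}+\tfrac{i}{n}P_{\mathcal V}$ be the mixture training distribution at leakage level $i/n$, let $f_i\in\mathcal F$ be the predictor learned at that level, and let $e_i=\mathbb E_{(x,y)\sim P_{\mathcal V}}\,\ell(f_i(x),y)$ be its expected validation loss. Suppose the learner is optimal under its training distribution, i.e. for every $i\in\{0,\dots,n\}$, $$f_i\in\operatorname*{arg\,min}_{f\in\mathcal F}\ \mathbb E_{(x,y)\sim M_i}\,\ell(f(x),y).$$ Then the sequence $e_0,e_1,\dots,e_n$ is monotonically decreasing, i.e. $e_i\ge e_{i+1}$ for all $i\in\{0,\dots,n-1\}$.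
   Context: All expected losses $\mathbb E_{(x,y)\sim P_{\mathcal T}}\ell(f(x),y)$ and $\mathbb E_{(x,y)\sim P_{\mathcal V}}\ell(f(x),y)$, $f\in\mathcal F$, are assumed to exist and be finite. The setting is unidirectional leakage from the validation distribution into the training distribution: at leakage level $p=i/n$, training data come from the mixture of $P_{\mathcal T}$ and $P_{\mathcal V}$ with weights $1-p$ and $p$, while validation data come from $P_{\mathcal V}$. "Monotonically decreasing" is meant in the weak sense (non-increasing). No uniqueness of minimizers is assumed; $f_i$ is any chosen minimizer. *)

theory Defs
  imports "HOL-Probability.Probability"
begin

text \<open>
  The mixture \<open>(1 - p) P + p Q\<close>, for \<open>p \<in> [0, 1]\<close> and \<open>P\<close>, \<open>Q\<close> on the same \<open>\<sigma>\<close>-algebra.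
  Outside this range the definition is not meaningful: \<^const>\<open>ennreal\<close> truncates negative
  weights to \<open>0\<close>.
\<close>

definition mixture :: "real \<Rightarrow> 'a measure \<Rightarrow> 'a measure \<Rightarrow> 'a measure" where
  "mixture p P Q = measure_of (space P) (sets P)
     (\<lambda>A. ennreal (1 - p) * emeasure P A + ennreal p * emeasure Q A)"

lemma space_mixture [simp]: "space (mixture p P Q) = space P"
  by (simp add: mixture_def)

lemma sets_mixture [simp]: "sets (mixture p P Q) = sets P"
  by (simp add: mixture_def)

lemma emeasure_mixture:
  assumes "sets Q = sets P" "A \<in> sets P"
  shows "emeasure (mixture p P Q) A = ennreal (1 - p) * emeasure P A + ennreal p * emeasure Q A"
proof (rule emeasure_measure_of[OF mixture_def])
  show "countably_additive (sets (mixture p P Q))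
     (\<lambda>A. ennreal (1 - p) * emeasure P A + ennreal p * emeasure Q A)"
  proof (rule countably_additiveI)
    fix B :: "nat \<Rightarrow> _"
    assume "range B \<subseteq> sets (mixture p P Q)" "disjoint_family B"
    then show "(\<Sum>i. ennreal (1 - p) * emeasure P (B i) + ennreal p * emeasure Q (B i))
      = ennreal (1 - p) * emeasure P (\<Union>i. B i) + ennreal p * emeasure Q (\<Union>i. B i)"
      using assms(1) by (simp add: suminf_add[symmetric] ennreal_suminf_cmult suminf_emeasure)
  qed
qed (use assms in \<open>auto simp: positive_def dest: sets.sets_into_space\<close>)

lemma prob_space_mixture:
  assumes "prob_space P" "prob_space Q" "sets Q = sets P" "0 \<le> p" "p \<le> 1"
  shows "prob_space (mixture p P Q)"
proof (rule prob_spaceI)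
  have "space Q = space P"
    using assms(3) by (rule sets_eq_imp_space_eq)
  then have "emeasure P (space P) = 1" "emeasure Q (space P) = 1"
    using prob_space.emeasure_space_1[OF assms(1)] prob_space.emeasure_space_1[OF assms(2)] by auto
  then show "emeasure (mixture p P Q) (space (mixture p P Q)) = 1"
    using assms by (simp add: emeasure_mixture ennreal_plus[symmetric] del: ennreal_plus)
qed

definition expected_loss ::
  "('z \<Rightarrow> 'y \<Rightarrow> real) \<Rightarrow> ('x \<times> 'y) measure \<Rightarrow> ('x \<Rightarrow> 'z) \<Rightarrow> real" where
  "expected_loss l P f = (\<integral>(x, y). l (f x) y \<partial>P)"

end

theory Submission
  imports Defs
begin

text \<open>
  The expected loss under the mixture of weight \<open>p\<close> is the affine function \<open>(1 - p) T + p V\<close> of the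
  two expected losses. For weights \<open>p < q\<close> with minimizers \<open>f\<close>, \<open>g\<close>, scaling the two optimality
  inequalities by \<open>1 - q\<close> and \<open>1 - p\<close> and adding them cancels the training losses and leaves
  \<open>(q - p) (V f - V g) \<ge> 0\<close>.
\<close>

lemma measurable_mixture [simp]: "measurable (mixture p P Q) N = measurable P N"
  by (rule measurable_cong_sets) simp_all

text \<open>Both sides are additive, homogeneous and continuous along increasing sequences in
  \<open>f\<close>, so induction over nonnegative measurable functions leaves only indicators, where
  \<open>emeasure_mixture\<close> applies.\<close>

lemma nn_integral_mixture:
  assumes sets: "sets Q = sets P" and "f \<in> borel_measurable P"
  shows "(\<integral>\<^sup>+ x. f x \<partial>mixture p P Q) =
    ennreal (1 - p) * (\<integral>\<^sup>+ x. f x \<partial>P) + ennreal p * (\<integral>\<^sup>+ x. f x \<partial>Q)"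
  using assms(2)
proof (induction rule: borel_measurable_induct)
  case (cong f g)
  have "integral\<^sup>N N f = integral\<^sup>N N g" if "space N = space P" for N
    using cong that by (auto intro: nn_integral_cong)
  then show ?case
    using cong sets_eq_imp_space_eq[OF sets] by simp
next
  case (set A)
  then show ?case
    using sets by (simp add: emeasure_mixture)
next
  case (mult u c)
  then show ?case
    using sets by (simp add: nn_integral_cmult measurable_cong_sets[OF sets refl]
        distrib_left mult.left_commute)
next
  case (add u v)
  then show ?case
    using sets by (simp add: nn_integral_add measurable_cong_sets[OF sets refl]
        distrib_left ac_simps)
next
  case (seq U)
  have meas: "\<And>i. U i \<in> borel_measurable Q"
    using seq(1) by (simp add: measurable_cong_sets[OF sets refl])
  \<comment> \<open>A supremum of sums splits into a sum of suprema only for increasing sequences;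
    \<open>c\<close> stands for either weight and \<open>N\<close> for \<open>P\<close> or
    \<open>Q\<close>.\<close>
  have inc: "incseq (\<lambda>i. c * (\<integral>\<^sup>+ x. U i x \<partial>N))" for c :: ennreal and N
    using \<open>incseq U\<close> by (auto simp: incseq_def le_fun_def intro!: mult_left_mono nn_integral_mono)
  have "(\<integral>\<^sup>+ x. (SUP i. U i) x \<partial>mixture p P Q) = (SUP i. \<integral>\<^sup>+ x. U i x \<partial>mixture p P Q)"
    unfolding SUP_apply using seq by (intro nn_integral_monotone_convergence_SUP) auto
  also have "\<dots> = (SUP i. ennreal (1 - p) * (\<integral>\<^sup>+ x. U i x \<partial>P) + ennreal p * (\<integral>\<^sup>+ x. U i x \<partial>Q))"
    using seq by simp
  also have "\<dots> = ennreal (1 - p) * (SUP i. \<integral>\<^sup>+ x. U i x \<partial>P) + ennreal p * (SUP i. \<integral>\<^sup>+ x. U i x \<partial>Q)"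
    by (simp add: ennreal_SUP_add inc SUP_mult_left_ennreal)
  also have "\<dots> = ennreal (1 - p) * (\<integral>\<^sup>+ x. (SUP i. U i) x \<partial>P) +
      ennreal p * (\<integral>\<^sup>+ x. (SUP i. U i) x \<partial>Q)"
    unfolding SUP_apply using seq meas by (simp add: nn_integral_monotone_convergence_SUP)
  finally show ?case .
qed

text \<open>The nonnegative case is applied to the positive and negative parts of \<open>f\<close>.
  Finiteness of the four integrals and \<open>p\<close> in [0, 1] let \<open>enn2real\<close> pass
  through sums and weights.\<close>

lemma integral_mixture:
  fixes f :: "'a \<Rightarrow> real"
  assumes sets: "sets Q = sets P" and p: "0 \<le> p" "p \<le> 1"
    and P: "integrable P f" and Q: "integrable Q f"
  shows "(\<integral>x. f x \<partial>mixture p P Q) = (1 - p) * (\<integral>x. f x \<partial>P) + p * (\<integral>x. f x \<partial>Q)"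
proof -
  have meas: "f \<in> borel_measurable P"
    using P by simp
  have nn: "(\<integral>\<^sup>+ x. ennreal (g x) \<partial>mixture p P Q) =
      ennreal (1 - p) * (\<integral>\<^sup>+ x. ennreal (g x) \<partial>P) + ennreal p * (\<integral>\<^sup>+ x. ennreal (g x) \<partial>Q)"
    if "g \<in> borel_measurable P" for g
    using that by (intro nn_integral_mixture sets) simp
  have fin: "(\<integral>\<^sup>+ x. ennreal (f x) \<partial>P) < \<infinity>" "(\<integral>\<^sup>+ x. ennreal (f x) \<partial>Q) < \<infinity>"
    "(\<integral>\<^sup>+ x. ennreal (- f x) \<partial>P) < \<infinity>" "(\<integral>\<^sup>+ x. ennreal (- f x) \<partial>Q) < \<infinity>"
    using P Q by (auto simp: real_integrable_def less_top)
  \<comment> \<open>Writing the integral as a difference of two nonnegative integrals presupposes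
    integrability under the mixture.\<close>
  have "integrable (mixture p P Q) f"
    using meas fin
    by (simp add: real_integrable_def nn ennreal_mult_eq_top_iff less_top)
  then show ?thesis
    using fin p P Q meas
    by (simp add: real_lebesgue_integral_def nn enn2real_plus enn2real_mult
        ennreal_mult_less_top algebra_simps)
qed

lemma expected_loss_mixture:
  assumes "sets Q = sets P" "0 \<le> p" "p \<le> 1"
    and "integrable P (\<lambda>(x, y). l (h x) y)" "integrable Q (\<lambda>(x, y). l (h x) y)"
  shows "expected_loss l (mixture p P Q) h = (1 - p) * expected_loss l P h + p * expected_loss l Q h"
  unfolding expected_loss_def using assms by (rule integral_mixture)

text \<open>Here \<open>s\<close>, \<open>v\<close> are the training and validation losses of the
  minimizer at weight \<open>p\<close>, and \<open>t\<close>, \<open>w\<close> those of the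
  minimizer at weight \<open>q\<close>.\<close>

lemma mixture_minimizers_antimono:
  fixes p q s t v w :: real
  assumes "p < q" "q \<le> 1"
    and min_p: "(1 - p) * s + p * v \<le> (1 - p) * t + p * w"
    and min_q: "(1 - q) * t + q * w \<le> (1 - q) * s + q * v"
  shows "w \<le> v"
proof -
  \<comment> \<open>Both multipliers are nonnegative. For \<open>q = 1\<close> the first one
    vanishes and \<open>min_q\<close> alone decides.\<close>
  have "(1 - q) * ((1 - p) * s + p * v) + (1 - p) * ((1 - q) * t + q * w)
      \<le> (1 - q) * ((1 - p) * t + p * w) + (1 - p) * ((1 - q) * s + q * v)"
    using assms by (intro add_mono mult_left_mono[OF min_p] mult_left_mono[OF min_q]) auto
  \<comment> \<open>The surviving coefficient is
    \<open>(1 - p) * q - (1 - q) * p = q - p\<close>.\<close>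
  then have "0 \<le> (q - p) * (v - w)"
    by (simp add: algebra_simps)
  then show ?thesis
    using \<open>p < q\<close> by (simp add: zero_le_mult_iff)
qed

theorem theorem3p1:
  fixes P\<^sub>T P\<^sub>V :: "('x \<times> 'y) measure"
    and F :: "('x \<Rightarrow> 'z) set"
    and l :: "'z \<Rightarrow> 'y \<Rightarrow> real"
    and n :: nat
    and f :: "nat \<Rightarrow> 'x \<Rightarrow> 'z"
    and M :: "nat \<Rightarrow> ('x \<times> 'y) measure"
    and e :: "nat \<Rightarrow> real"
  assumes "prob_space P\<^sub>T" and "prob_space P\<^sub>V"
    and "sets P\<^sub>V = sets P\<^sub>T"
    and "n \<ge> 1"
    and "\<And>h. h \<in> F \<Longrightarrow> integrable P\<^sub>T (\<lambda>(x, y). l (h x) y)"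
    and "\<And>h. h \<in> F \<Longrightarrow> integrable P\<^sub>V (\<lambda>(x, y). l (h x) y)"
    and "\<And>i. i \<le> n \<Longrightarrow> M i = mixture (real i / real n) P\<^sub>T P\<^sub>V"
    and "\<And>i. i \<le> n \<Longrightarrow> e i = expected_loss l P\<^sub>V (f i)"
    and "\<And>i. i \<le> n \<Longrightarrow> is_arg_min (expected_loss l (M i)) (\<lambda>h. h \<in> F) (f i)"
  shows "\<forall>i<n. e i \<ge> e (i + 1)"
proof (intro allI impI)
  fix i assume "i < n"
  then have i: "i \<le> n" "i + 1 \<le> n"
    by simp_all
  have loss: "expected_loss l (M j) h =
      (1 - real j / real n) * expected_loss l P\<^sub>T h + real j / real n * expected_loss l P\<^sub>V h"
    if "j \<le> n" "h \<in> F" for j h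
    using that assms(3-7) by (simp add: expected_loss_mixture)
  have mem: "f j \<in> F" if "j \<le> n" for j
    using assms(9)[OF that] by (simp add: is_arg_min_def)
  \<comment> \<open>\<open>is_arg_min\<close> only excludes strictly better members of
    \<open>F\<close>; linearity of the order yields \<open>\<le>\<close>.\<close>
  have opt: "expected_loss l (M j) (f j) \<le> expected_loss l (M j) h" if "j \<le> n" "h \<in> F" for j h
    using assms(9)[OF that(1)] that(2) by (simp add: is_arg_min_linorder)
  \<comment> \<open>Each of the two neighbouring minimizers is tested against the other at its own
    level; \<open>loss\<close> expands both comparisons into the affine form.\<close>
  have "expected_loss l P\<^sub>V (f (i + 1)) \<le> expected_loss l P\<^sub>V (f i)"
  proof (rule mixture_minimizers_antimono)
    show "real i / real n < real (i + 1) / real n" "real (i + 1) / real n \<le> 1"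
      using i by (simp_all add: divide_strict_right_mono)
  qed (use opt[OF i(1) mem[OF i(2)]] opt[OF i(2) mem[OF i(1)]] in
      \<open>simp_all only: loss[OF i(1) mem[OF i(1)]] loss[OF i(1) mem[OF i(2)]]
        loss[OF i(2) mem[OF i(1)]] loss[OF i(2) mem[OF i(2)]]\<close>)
  then show "e i \<ge> e (i + 1)"
    using assms(8) i by simp
qed

end
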